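(* Let $d$ and $d'$ be two proper left invariant metrics on a group $G$ which induce the same topology on $G$. Then the identity map $\mathrm{id}:(G,d)\to(G,d')$ is a coarse equivalence.
   Context: A metric $d$ on a set $X$ is proper if every closed ball $\{y\in X\mid d(x,y)\le r\}$ is compact. A metric $d$ on a group $G$ is left invariant if $d(x,y)=d(gx,gy)$ for all $g,x,y\in G$. A map $f:(X,d)\to(Y,d')$ between metric spaces is a coarse embedding if there are functions $\rho_1,\rho_2:\mathbb R_+\to\mathbb R_+$ tending to infinity such that $\rho_1(d(x,x'))\le d'(f(x),f(x'))\le\rho_2(d(x,x'))$ for all $x,x'\in X$. Here $\mathbb R_+=[0,\infty)$. A coarse embedding $f$ is a coarse equivalence if the image $f(X)$ is $R$-dense in $Y$ for some $R>0$ (every point of $Y$ is within distance $R$ of $f(X)$). *)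

theory Defs
  imports "HOL-Analysis.Analysis" "HOL-Algebra.Group"
begin

definition proper_metric :: "'a set \<Rightarrow> ('a \<Rightarrow> 'a \<Rightarrow> real) \<Rightarrow> bool" where
  "proper_metric X d \<longleftrightarrow> Metric_space X d \<and>
     (\<forall>x\<in>X. \<forall>r. compactin (Metric_space.mtopology X d) (Metric_space.mcball X d x r))"

definition left_invariant_metric :: "('a, 'b) monoid_scheme \<Rightarrow> ('a \<Rightarrow> 'a \<Rightarrow> real) \<Rightarrow> bool" where
  "left_invariant_metric G d \<longleftrightarrow> Metric_space (carrier G) d \<and>
     (\<forall>g\<in>carrier G. \<forall>x\<in>carrier G. \<forall>y\<in>carrier G.
        d x y = d (g \<otimes>\<^bsub>G\<^esub> x) (g \<otimes>\<^bsub>G\<^esub> y))"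

(* A function from [0,\<infinity>) to [0,\<infinity>) is represented by a total real function that is
   nonnegative on {0..}; its values at negative arguments are irrelevant. *)
definition control_function :: "(real \<Rightarrow> real) \<Rightarrow> bool" where
  "control_function \<rho> \<longleftrightarrow> \<rho> \<in> {0..} \<rightarrow> {0..} \<and> filterlim \<rho> at_top at_top"

definition coarse_embedding ::
  "'a set \<Rightarrow> ('a \<Rightarrow> 'a \<Rightarrow> real) \<Rightarrow> 'b set \<Rightarrow> ('b \<Rightarrow> 'b \<Rightarrow> real) \<Rightarrow> ('a \<Rightarrow> 'b) \<Rightarrow> bool" where
  "coarse_embedding X d Y d' f \<longleftrightarrow>
     Metric_space X d \<and> Metric_space Y d' \<and> f \<in> X \<rightarrow> Y \<and>
     (\<exists>\<rho>\<^sub>1 \<rho>\<^sub>2. control_function \<rho>\<^sub>1 \<and> control_function \<rho>\<^sub>2 \<and>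
        (\<forall>x\<in>X. \<forall>x'\<in>X. \<rho>\<^sub>1 (d x x') \<le> d' (f x) (f x') \<and> d' (f x) (f x') \<le> \<rho>\<^sub>2 (d x x')))"

definition coarse_equivalence ::
  "'a set \<Rightarrow> ('a \<Rightarrow> 'a \<Rightarrow> real) \<Rightarrow> 'b set \<Rightarrow> ('b \<Rightarrow> 'b \<Rightarrow> real) \<Rightarrow> ('a \<Rightarrow> 'b) \<Rightarrow> bool" where
  "coarse_equivalence X d Y d' f \<longleftrightarrow>
     coarse_embedding X d Y d' f \<and>
     (\<exists>R>0. \<forall>y\<in>Y. \<exists>x\<in>X. d' y (f x) \<le> R)"

end

theory Submission
  imports Defs
begin

text \<open>
  Everything follows from one estimate: for each radius \<open>r\<close>, pairs of points that are
  \<open>r\<close>-close for one metric are uniformly close for the other. Left invariance moves such a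
  pair to \<open>(\<one>, x\<inverse>y)\<close>, so only the closed ball of radius \<open>r\<close> around the identity matters
  (\<open>left_invariant_uniform_bound\<close>). That ball is compact by properness; compactness depends
  only on the topology, so the ball is also compact, hence bounded, for the second metric
  (\<open>compact_imp_bounded_for_equivalent_metric\<close>).

  Applied in both directions, the estimate yields the control functions
  (\<open>control_functions_from_sublevel_bounds\<close>). Density of the image is trivial for the
  identity map.
\<close>

text \<open>The closed \<open>d\<close>-ball around \<open>a\<close> is compact for the common topology, and compact sets
  are bounded for every metric inducing that topology.\<close>

lemma compact_imp_bounded_for_equivalent_metric:
  assumes d: "proper_metric X d" and d': "Metric_space X d'"
    and top: "Metric_space.mtopology X d = Metric_space.mtopology X d'"
    and a: "a \<in> X"
  shows "\<exists>B. \<forall>z\<in>X. d a z \<le> r \<longrightarrow> d' a z \<le> B"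
proof -
  interpret D: Metric_space X d using d by (simp add: proper_metric_def)
  interpret D': Metric_space X d' by (fact d')
  have "compactin D'.mtopology (D.mcball a r)"
    using d a top by (simp add: proper_metric_def)
  then have "D'.mbounded (D.mcball a r)"
    by (rule D'.compactin_imp_mbounded)
  then obtain B where B: "\<forall>x\<in>D.mcball a r. \<forall>y\<in>D.mcball a r. d' x y \<le> B"
    unfolding D'.mbounded_alt by blast
  have "d' a z \<le> B" if z: "z \<in> X" "d a z \<le> r" for z
  proof -
    have "z \<in> D.mcball a r" using z a by simp
    moreover have "a \<in> D.mcball a r"
      using z a order_trans[OF D.nonneg] by simp
    ultimately show ?thesis using B by blast
  qed
  then show ?thesis by blast
qed

text \<open>Translating by \<open>x\<inverse>\<close> turns a bound at the identity into one that is uniform in the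
  base point.\<close>

lemma left_invariant_uniform_bound:
  assumes G: "group G"
    and d: "left_invariant_metric G d" and d': "left_invariant_metric G d'"
    and bound: "\<forall>z\<in>carrier G. d \<one>\<^bsub>G\<^esub> z \<le> r \<longrightarrow> d' \<one>\<^bsub>G\<^esub> z \<le> B"
    and xy: "x \<in> carrier G" "y \<in> carrier G" "d x y \<le> r"
  shows "d' x y \<le> B"
proof -
  interpret group G by (fact G)
  let ?z = "inv\<^bsub>G\<^esub> x \<otimes>\<^bsub>G\<^esub> y"
  have z: "?z \<in> carrier G" and "inv\<^bsub>G\<^esub> x \<in> carrier G" using xy by auto
  have "e x y = e \<one>\<^bsub>G\<^esub> ?z" if "left_invariant_metric G e" for e
  proof -
    have "e x y = e (inv\<^bsub>G\<^esub> x \<otimes>\<^bsub>G\<^esub> x) ?z"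
      using that xy unfolding left_invariant_metric_def by blast
    then show ?thesis using xy by simp
  qed
  from this[OF d] this[OF d'] show ?thesis using bound z xy(3) by simp
qed

text \<open>
  This isolates the construction of control functions from the geometry; in the application the
  index set consists of the pairs of points. If \<open>v \<le> B r\<close> holds wherever \<open>u \<le> r\<close>, then
  \<open>t + \<bar>B t\<bar>\<close> is an upper control function: evaluating \<open>B\<close> at \<open>r = u i\<close> bounds \<open>v i\<close>, and
  the summand \<open>t\<close> makes the function tend to infinity. The lower one is the infimum of \<open>v\<close> over the points where
  \<open>u \<ge> t\<close>; it tends to infinity because \<open>v \<le> N\<close> bounds \<open>u\<close>.
\<close>

lemma control_functions_from_sublevel_bounds:
  fixes u v :: "'i \<Rightarrow> real"
  assumes u: "\<And>i. i \<in> I \<Longrightarrow> 0 \<le> u i" and v: "\<And>i. i \<in> I \<Longrightarrow> 0 \<le> v i"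
    and uv: "\<And>r. \<exists>B. \<forall>i\<in>I. u i \<le> r \<longrightarrow> v i \<le> B"
    and vu: "\<And>r. \<exists>B. \<forall>i\<in>I. v i \<le> r \<longrightarrow> u i \<le> B"
  obtains \<rho>\<^sub>1 \<rho>\<^sub>2 where "control_function \<rho>\<^sub>1" "control_function \<rho>\<^sub>2"
    "\<And>i. i \<in> I \<Longrightarrow> \<rho>\<^sub>1 (u i) \<le> v i" "\<And>i. i \<in> I \<Longrightarrow> v i \<le> \<rho>\<^sub>2 (u i)"
proof -
  obtain B where B: "\<And>r i. i \<in> I \<Longrightarrow> u i \<le> r \<Longrightarrow> v i \<le> B r"
    using uv by metis
  obtain C where C: "\<And>r i. i \<in> I \<Longrightarrow> v i \<le> r \<Longrightarrow> u i \<le> C r"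
    using vu by metis
  define \<rho>\<^sub>2 where "\<rho>\<^sub>2 t = t + \<bar>B t\<bar>" for t
  \<comment> \<open>Inserting \<open>t\<close> keeps the set nonempty, and the infimum unbounded in \<open>t\<close>, when \<open>u\<close> is bounded.\<close>
  define T where "T t = insert t (v ` {i\<in>I. t \<le> u i})" for t
  define \<rho>\<^sub>1 where "\<rho>\<^sub>1 t = Inf (T t)" for t
  have "filterlim \<rho>\<^sub>2 at_top at_top"
    by (rule filterlim_at_top_mono[OF filterlim_ident]) (simp add: \<rho>\<^sub>2_def)
  then have c2: "control_function \<rho>\<^sub>2"
    by (auto simp: control_function_def \<rho>\<^sub>2_def)
  have ge: "N \<le> \<rho>\<^sub>1 t" if "\<And>s. s \<in> T t \<Longrightarrow> N \<le> s" for N t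
    unfolding \<rho>\<^sub>1_def using that by (intro cInf_greatest) (auto simp: T_def)
  have "filterlim \<rho>\<^sub>1 at_top at_top"
    unfolding filterlim_at_top
  proof
    fix N
    show "eventually (\<lambda>t. N \<le> \<rho>\<^sub>1 t) at_top"
      using eventually_gt_at_top[of "max N (C N)"]
    proof eventually_elim
      case (elim t)
      show ?case
      proof (rule ge)
        fix s assume "s \<in> T t"
        then consider "s = t" | i where "i \<in> I" "t \<le> u i" "s = v i"
          by (auto simp: T_def)
        then show "N \<le> s"
        proof cases
          case 2
          then show ?thesis using elim C[of i N] by force
        qed (use elim in simp)
      qed
    qed
  qed
  moreover have "0 \<le> \<rho>\<^sub>1 t" if "0 \<le> t" for t
    using that v by (intro ge) (auto simp: T_def)
  ultimately have c1: "control_function \<rho>\<^sub>1"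
    by (auto simp: control_function_def)
  have le1: "\<rho>\<^sub>1 (u i) \<le> v i" if "i \<in> I" for i
    unfolding \<rho>\<^sub>1_def
  proof (rule cInf_lower)
    show "v i \<in> T (u i)" using that by (auto simp: T_def)
    show "bdd_below (T (u i))"
      using u[OF that] v by (intro bdd_belowI[of _ 0]) (auto simp: T_def)
  qed
  have le2: "v i \<le> \<rho>\<^sub>2 (u i)" if "i \<in> I" for i
    using B[OF that order_refl] u[OF that] by (simp add: \<rho>\<^sub>2_def)
  show thesis using that c1 c2 le1 le2 by blast
qed

theorem proposition1p1:
  fixes G :: "('a, 'b) monoid_scheme" and d d' :: "'a \<Rightarrow> 'a \<Rightarrow> real"
  assumes "group G"
    and "Metric_space (carrier G) d"
    and "Metric_space (carrier G) d'"
    and "proper_metric (carrier G) d"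
    and "proper_metric (carrier G) d'"
    and "left_invariant_metric G d"
    and "left_invariant_metric G d'"
    and "Metric_space.mtopology (carrier G) d = Metric_space.mtopology (carrier G) d'"
  shows "coarse_equivalence (carrier G) d (carrier G) d' id"
proof -
  interpret group G by (fact assms(1))
  interpret D: Metric_space "carrier G" d by (fact assms(2))
  interpret D': Metric_space "carrier G" d' by (fact assms(3))
  let ?I = "carrier G \<times> carrier G"
  have bound: "\<exists>B. \<forall>p\<in>?I. case_prod d p \<le> r \<longrightarrow> case_prod d' p \<le> B" for r
  proof -
    obtain B where B: "\<forall>z\<in>carrier G. d \<one>\<^bsub>G\<^esub> z \<le> r \<longrightarrow> d' \<one>\<^bsub>G\<^esub> z \<le> B"
      using compact_imp_bounded_for_equivalent_metric[OF assms(4,3,8) one_closed, of r] by blast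
    show ?thesis
      using left_invariant_uniform_bound[OF assms(1,6,7) B] by (intro exI[of _ B]) auto
  qed
  have bound': "\<exists>B. \<forall>p\<in>?I. case_prod d' p \<le> r \<longrightarrow> case_prod d p \<le> B" for r
  proof -
    obtain B where B: "\<forall>z\<in>carrier G. d' \<one>\<^bsub>G\<^esub> z \<le> r \<longrightarrow> d \<one>\<^bsub>G\<^esub> z \<le> B"
      using compact_imp_bounded_for_equivalent_metric[OF assms(5,2) assms(8)[symmetric] one_closed, of r] by blast
    show ?thesis
      using left_invariant_uniform_bound[OF assms(1,7,6) B] by (intro exI[of _ B]) auto
  qed
  obtain \<rho>\<^sub>1 \<rho>\<^sub>2 where c: "control_function \<rho>\<^sub>1" "control_function \<rho>\<^sub>2"
    and l1: "\<And>p. p \<in> ?I \<Longrightarrow> \<rho>\<^sub>1 (case_prod d p) \<le> case_prod d' p"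
    and l2: "\<And>p. p \<in> ?I \<Longrightarrow> case_prod d' p \<le> \<rho>\<^sub>2 (case_prod d p)"
    by (rule control_functions_from_sublevel_bounds[of ?I "case_prod d" "case_prod d'", OF _ _ bound bound'])
      auto
  have "\<rho>\<^sub>1 (d x y) \<le> d' x y \<and> d' x y \<le> \<rho>\<^sub>2 (d x y)" if "x \<in> carrier G" "y \<in> carrier G" for x y
    using l1[of "(x, y)"] l2[of "(x, y)"] that by simp
  then have "coarse_embedding (carrier G) d (carrier G) d' id"
    unfolding coarse_embedding_def
    by (intro conjI assms(2,3) exI[of _ \<rho>\<^sub>1] exI[of _ \<rho>\<^sub>2] c) auto
  moreover have "\<exists>R>0. \<forall>y\<in>carrier G. \<exists>x\<in>carrier G. d' y (id x) \<le> R"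
    by (intro exI[of _ 1] conjI ballI) force+
  ultimately show ?thesis
    by (simp add: coarse_equivalence_def)
qed

end
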